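(* For every integer $k\ge2$, there exist $k$-growth systems that are not $k$-circuit bounded.
   Context: An independence system $(S,\mathcal{I})$ is a finite set $S$ with a nonempty downward-closed family $\mathcal{I}\subseteq2^S$ of independent sets. Circuits are the inclusion-wise minimal non-independent sets. A basis of $X\subseteq S$ is an inclusion-wise maximal independent subset of $X$. $k$-growth: for all $X\subseteq S$ and all $I\in\mathcal{I}$ there is a partition $(Q,Z)$ of $I\setminus X$ with $|Z|\le k|X\setminus I|$ such that $P\cup Q\in\mathcal{I}$ for every basis $P$ of $X$. $k$-circuit bounded: for every $I\in\mathcal{I}$ and every $e\in S\setminus I$, the set $I\cup\{e\}$ contains at most $k$ distinct circuits. *)

theory Defs
  imports Main
begin

definition indep_system :: "'a set \<Rightarrow> 'a set set \<Rightarrow> bool" where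
  "indep_system S \<I> \<longleftrightarrow>
     finite S \<and> \<I> \<subseteq> Pow S \<and> \<I> \<noteq> {} \<and> (\<forall>I\<in>\<I>. \<forall>J\<subseteq>I. J \<in> \<I>)"

definition circuit :: "'a set \<Rightarrow> 'a set set \<Rightarrow> 'a set \<Rightarrow> bool" where
  "circuit S \<I> C \<longleftrightarrow> C \<subseteq> S \<and> C \<notin> \<I> \<and> (\<forall>D\<subseteq>S. D \<notin> \<I> \<longrightarrow> \<not> D \<subset> C)"

definition basis_of :: "'a set set \<Rightarrow> 'a set \<Rightarrow> 'a set \<Rightarrow> bool" where
  "basis_of \<I> X P \<longleftrightarrow> P \<in> \<I> \<and> P \<subseteq> X \<and> (\<forall>J\<in>\<I>. J \<subseteq> X \<longrightarrow> \<not> P \<subset> J)"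

text \<open>The parts of the partition may be empty; the choice of the pair depends on \<open>X\<close> and \<open>I\<close>
  only, so the same \<open>Q\<close> has to serve all bases \<open>P\<close> of \<open>X\<close>.\<close>

definition k_growth :: "nat \<Rightarrow> 'a set \<Rightarrow> 'a set set \<Rightarrow> bool" where
  "k_growth k S \<I> \<longleftrightarrow>
     (\<forall>X\<subseteq>S. \<forall>I\<in>\<I>. \<exists>Q Z. Q \<union> Z = I - X \<and> Q \<inter> Z = {} \<and>
        card Z \<le> k * card (X - I) \<and>
        (\<forall>P. basis_of \<I> X P \<longrightarrow> P \<union> Q \<in> \<I>))"

definition k_circuit_bounded :: "nat \<Rightarrow> 'a set \<Rightarrow> 'a set set \<Rightarrow> bool" where
  "k_circuit_bounded k S \<I> \<longleftrightarrow>
     (\<forall>I\<in>\<I>. \<forall>e\<in>S - I. card {C. circuit S \<I> C \<and> C \<subseteq> I \<union> {e}} \<le> k)"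

end

theory Submission
  imports Defs
begin

text \<open>On the ground set \<open>{0..k + 1}\<close> let the circuits be the triples \<open>{0, i, j}\<close>, that is, let the
  edges of the complete graph on the \<open>k + 1\<close> nonzero vertices be completed by \<open>0\<close>. That graph has
  a vertex cover of size \<open>k\<close>, which is what growth asks for, but it has more than \<open>k\<close> edges
  because \<open>k \<ge> 2\<close>.\<close>

definition cone_system :: "nat \<Rightarrow> nat set set" where
  "cone_system k = {I. I \<subseteq> {0..Suc k} \<and> (0 \<in> I \<longrightarrow> card I \<le> 2)}"

lemma indep_system_cone_system: "indep_system {0..Suc k} (cone_system k)"
proof -
  have "J \<in> cone_system k" if "I \<in> cone_system k" "J \<subseteq> I" for I J
  proof -
    have "finite I"
      using that(1) finite_subset by (auto simp: cone_system_def)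
    then show ?thesis
      using that card_mono[of I J] by (auto simp: cone_system_def)
  qed
  moreover have "{} \<in> cone_system k"
    by (simp add: cone_system_def)
  moreover have "cone_system k \<subseteq> Pow {0..Suc k}"
    by (auto simp: cone_system_def)
  ultimately show ?thesis
    unfolding indep_system_def by blast
qed

lemma basis_of_indep:
  assumes "X \<in> \<I>" "basis_of \<I> X P"
  shows "P = X"
  using assms unfolding basis_of_def by blast

text \<open>Discarding all of \<open>I - X\<close> is affordable unless it has more than
  \<open>k\<close> elements while \<open>X\<close> is not contained in \<open>I\<close>. The size of
  the ground set then leaves a single critical pair, \<open>X = {0}\<close> and
  \<open>I = {1..Suc k}\<close>.\<close>

lemma k_growth_cone_system:
  assumes "k \<ge> 2"
  shows "k_growth k {0..Suc k} (cone_system k)"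
  unfolding k_growth_def
proof (intro allI ballI impI)
  fix X I
  assume X: "X \<subseteq> {0..Suc k}" and I: "I \<in> cone_system k"
  have finX: "finite X" and finI: "finite I"
    using X I finite_subset by (auto simp: cone_system_def)
  show "\<exists>Q Z. Q \<union> Z = I - X \<and> Q \<inter> Z = {} \<and> card Z \<le> k * card (X - I) \<and>
      (\<forall>P. basis_of (cone_system k) X P \<longrightarrow> P \<union> Q \<in> cone_system k)"
  proof (cases "X \<subseteq> I")
    case True
    then have "X \<in> cone_system k"
      using indep_system_cone_system I unfolding indep_system_def by blast
    \<comment> \<open>The only basis of the independent set \<open>X\<close> is \<open>X\<close>
      itself, so \<open>P \<union> (I - X)\<close> is just \<open>I\<close> and nothing has to be
      discarded.\<close>
    then have "P \<union> (I - X) \<in> cone_system k" if "basis_of (cone_system k) X P" for P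
      using basis_of_indep[OF _ that] True I by (simp add: Un_absorb1)
    then show ?thesis
      by (intro exI[of _ "I - X"] exI[of _ "{}"]) simp
  next
    case nsub: False
    show ?thesis
    proof (cases "card (I - X) \<le> k * card (X - I)")
      case True
      then show ?thesis
        by (intro exI[of _ "{}"] exI[of _ "I - X"]) (simp add: basis_of_def)
    next
      case False
      have "card (X - I) \<ge> 1"
        using nsub finX by (simp add: Suc_leI card_gt_0_iff)
      then have k_le: "k \<le> k * card (X - I)"
        by (metis mult_le_mono2 nat_mult_1_right)
      with False have large: "k < card (I - X)"
        by linarith
      then have "k < card I"
        using card_mono[OF finI, of "I - X"] by auto
      \<comment> \<open>An independent set containing \<open>0\<close> has at most two elements,
        whereas \<open>card I > k \<ge> 2\<close>.\<close>
      then have "I \<subseteq> {1..Suc k}"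
        using I assms by (auto simp: cone_system_def Suc_le_eq subset_iff intro: gr0I)
      \<comment> \<open>More than \<open>k\<close> elements inside a set of \<open>k + 1\<close>
        elements exhaust it.\<close>
      moreover have "I - X = {1..Suc k}"
      proof (rule card_seteq)
        show "I - X \<subseteq> {1..Suc k}"
          using \<open>I \<subseteq> {1..Suc k}\<close> by blast
        show "card {1..Suc k} \<le> card (I - X)"
          using large by simp
      qed simp
      ultimately have IX: "I = {1..Suc k}" "X \<inter> I = {}"
        by blast+
      have X0: "X = {0}"
      proof -
        have "x = 0" if "x \<in> X" for x
        proof -
          have "x \<le> Suc k" "x \<notin> {1..Suc k}"
            using that X IX by auto
          then show ?thesis
            by simp
        qed
        then show ?thesis
          using nsub by blast
      qed
      \<comment> \<open>Next to \<open>0\<close> one nonzero vertex can be kept. The other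
        \<open>k\<close> form the vertex cover of the complete graph that is discarded as
        \<open>Z\<close>, meeting the bound with equality.\<close>
      have "P \<union> {1} \<in> cone_system k" if "basis_of (cone_system k) X P" for P
        using that X0 by (auto simp: basis_of_def cone_system_def subset_singleton_iff)
      moreover have "{1} \<union> {2..Suc k} = I - X"
        using IX X0 by auto
      moreover have "card {2..Suc k} \<le> k * card (X - I)"
        using k_le by simp
      ultimately show ?thesis
        by (intro exI[of _ "{1}"] exI[of _ "{2..Suc k}"]) simp
    qed
  qed
qed

text \<open>Minimality is a matter of counting: a proper subset of a triple has at most two
  elements, and every such subset of the ground set is independent.\<close>

lemma circuit_cone_system:
  assumes "i \<in> {1..Suc k}" "j \<in> {1..Suc k}" "i \<noteq> j"
  shows "circuit {0..Suc k} (cone_system k) {0, i, j}"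
  unfolding circuit_def
proof (intro conjI allI impI notI)
  show "{0, i, j} \<subseteq> {0..Suc k}"
    using assms by auto
  show False if "{0, i, j} \<in> cone_system k"
    using that assms by (auto simp: cone_system_def)
  show False if "D \<subseteq> {0..Suc k}" "D \<notin> cone_system k" "D \<subset> {0, i, j}" for D
  proof -
    have "card D < card {0, i, j}"
      using that(3) by (intro psubset_card_mono) auto
    then have "card D \<le> 2"
      using assms by auto
    then show False
      using that by (simp add: cone_system_def)
  qed
qed

text \<open>Adding \<open>0\<close> to \<open>{1..Suc k}\<close> creates \<open>k\<close> circuits
  from the edges at vertex 1, and the edge between 2 and 3 gives one more.\<close>

lemma not_k_circuit_bounded_cone_system:
  assumes "k \<ge> 2"
  shows "\<not> k_circuit_bounded k {0..Suc k} (cone_system k)"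
proof
  assume bounded: "k_circuit_bounded k {0..Suc k} (cone_system k)"
  define \<C> where "\<C> = {C. circuit {0..Suc k} (cone_system k) C \<and> C \<subseteq> {1..Suc k} \<union> {0}}"
  define \<F> where "\<F> = (\<lambda>j. {0, 1, j}) ` {2..Suc k}"
  have "{1..Suc k} \<in> cone_system k" "0 \<in> {0..Suc k} - {1..Suc k}"
    by (auto simp: cone_system_def)
  then have le: "card \<C> \<le> k"
    using bounded unfolding k_circuit_bounded_def \<C>_def by blast
  have fin: "finite \<C>"
    unfolding \<C>_def by (rule finite_subset[of _ "Pow ({1..Suc k} \<union> {0})"]) auto
  \<comment> \<open>Here \<open>k \<ge> 2\<close> ensures that the vertex 3 lies in
    \<open>{1..Suc k}\<close>.\<close>
  have sub: "insert {0, 2, 3} \<F> \<subseteq> \<C>"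
    using assms unfolding \<F>_def \<C>_def by (auto intro!: circuit_cone_system)
  have "card (insert {0, 2, 3} \<F>) \<le> k"
    using card_mono[OF fin sub] le by (rule le_trans)
  moreover have "inj_on (\<lambda>j. {0, 1, j}) {2..Suc k}"
  proof (rule inj_onI)
    fix i j :: nat
    assume i: "i \<in> {2..Suc k}" and eq: "{0, 1, i} = {0, 1, j}"
    have "i \<in> {0, 1, i}"
      by simp
    then have "i \<in> {0, 1, j}"
      by (simp only: eq)
    then show "i = j"
      using i by auto
  qed
  then have "card \<F> = k"
    unfolding \<F>_def by (simp add: card_image)
  \<comment> \<open>Vertex 1 separates the star from the additional circuit, so that the count is
    exactly \<open>k + 1\<close>.\<close>
  moreover have "1 \<in> C" if "C \<in> \<F>" for C
    using that unfolding \<F>_def by blast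
  then have "{0, 2, 3} \<notin> \<F>"
    by force
  moreover have "finite \<F>"
    unfolding \<F>_def by simp
  ultimately show False
    by simp
qed

theorem theorem12:
  fixes k :: nat
  assumes "k \<ge> 2"
  shows "\<exists>(S :: nat set) \<I>. indep_system S \<I> \<and> k_growth k S \<I> \<and> \<not> k_circuit_bounded k S \<I>"
  using indep_system_cone_system[of k] k_growth_cone_system[OF assms]
    not_k_circuit_bounded_cone_system[OF assms]
  by (intro exI[of _ "{0..Suc k}"] exI[of _ "cone_system k"] conjI)

end
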